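(* Let $m,n\ge1$ be integers and $S=\{00,\ 01^m0,\ 01^n0\}$ (where $1^k$ denotes $k$ consecutive $1$s). The Seeker wins the Renyi-Ulam game with lie restriction $r(S)$ if and only if $\gcd(m,n)=1$.
   Context: For a set $S$ of nonempty binary strings, $r(S)$ is the set of all finite binary strings that contain no element of $S$ as a contiguous substring. Renyi-Ulam game with lie restriction $R$: the Obscurer picks $x\in\{1,\dots,n\}$; on each turn the Seeker asks whether $x$ lies in a chosen subset and the Obscurer answers yes or no. For a candidate $y$, its lie pattern is the binary string whose $i$-th bit is $1$ iff the $i$-th answer is false for $y$. The Obscurer's answers must keep the lie pattern of her number in $R$ after every answer. The Seeker wins for $n$ if he has an adaptive strategy which after finitely many questions guarantees that at most one $y\in\{1,\dots,n\}$ has its lie pattern in $R$. "The Seeker wins" means he wins for every $n\ge1$. *)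

theory Defs
  imports Main "HOL-Library.Sublist"
begin

text \<open>Binary strings are of type \<^typ>\<open>bool list\<close>, with \<^const>\<open>True\<close> for the bit 1.\<close>

definition r :: "bool list set \<Rightarrow> bool list set" where
  "r S = {w. \<forall>s\<in>S. \<not> sublist s w}"

text \<open>
  A strategy of the Seeker maps the list of answers received so far (oldest first, \<^const>\<open>True\<close> for
  yes) to the subset he asks about next. The \<open>i\<close>-th question is therefore
  \<open>\<sigma> (take i as)\<close>, and its answer \<open>as ! i\<close> is false for \<open>y\<close> iff it differs from the truth value
  of \<open>y \<in> \<sigma> (take i as)\<close>.
\<close>

type_synonym strategy = "bool list \<Rightarrow> nat set"

definition lie_pattern :: "strategy \<Rightarrow> bool list \<Rightarrow> nat \<Rightarrow> bool list" where
  "lie_pattern \<sigma> as y = map (\<lambda>i. as ! i \<noteq> (y \<in> \<sigma> (take i as))) [0..<length as]"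

definition legal_answers :: "bool list set \<Rightarrow> strategy \<Rightarrow> nat \<Rightarrow> bool list \<Rightarrow> bool" where
  "legal_answers R \<sigma> x as \<longleftrightarrow> (\<forall>i\<in>{1..length as}. lie_pattern \<sigma> (take i as) x \<in> R)"

text \<open>
  The number \<open>k\<close> of questions is a uniform bound over all plays. There are only two possible
  answers to each question, so by Koenig's lemma this is no restriction compared with a number of
  questions depending on the play; and since \<open>r S\<close> is closed under prefixes, asking further
  questions never enlarges the set of remaining candidates.
\<close>

definition seeker_wins_for :: "bool list set \<Rightarrow> nat \<Rightarrow> bool" where
  "seeker_wins_for R n \<longleftrightarrow>
     (\<exists>\<sigma>. (\<forall>h. \<sigma> h \<subseteq> {1..n}) \<and>
       (\<exists>k. \<forall>x\<in>{1..n}. \<forall>as. length as = k \<longrightarrow> legal_answers R \<sigma> x as \<longrightarrow>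
          card {y\<in>{1..n}. lie_pattern \<sigma> as y \<in> R} \<le> 1))"

definition seeker_wins :: "bool list set \<Rightarrow> bool" where
  "seeker_wins R \<longleftrightarrow> (\<forall>n\<ge>1. seeker_wins_for R n)"

end

theory Submission
  imports Defs
begin

text \<open>
  Write \<open>(a, b)\<close> for the numbers of 1s after the last 0 in the lie patterns of two candidates.

  Suppose \<open>gcd m n = 1\<close>. Since candidates can be eliminated one at a time, it suffices to kill one
  of two given candidates. Giving both of them a 0 leads to \<open>(0, 0)\<close>, where a question separating
  them kills one; so the Seeker can let both counts increase at will. Hence \<open>(0, m)\<close> and \<open>(0, n)\<close>
  are won, and so is \<open>(0, k)\<close> as soon as \<open>(0, p)\<close> and \<open>(0, k + p)\<close> are won for some \<open>p \<ge> 1\<close>: wait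
  until \<open>(p - 1, k + p - 1)\<close> and separate. By the subtractive Euclidean algorithm \<open>(0, 1)\<close> is won,
  and two separating questions lead from any position to a dead candidate or to \<open>(0, 1)\<close>.

  If \<open>d = gcd m n > 1\<close>, the Obscurer keeps two candidates alive by maintaining \<open>a \<noteq> b\<close> modulo \<open>d\<close>
  and never closing a gap of length divisible by \<open>d\<close>.
\<close>

text \<open>The string 00 is \<open>gap 0\<close>, so all three forbidden strings have one
  form.\<close>

abbreviation gap :: "nat \<Rightarrow> bool list" where
  "gap k \<equiv> False # replicate k True @ [False]"

lemma r_sublist: "w \<in> r S \<Longrightarrow> sublist v w \<Longrightarrow> v \<in> r S"
  unfolding r_def using sublist_order.order_trans by blast

lemma r_prefix: "u @ v \<in> r S \<Longrightarrow> u \<in> r S"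
  by (erule r_sublist) (simp add: sublist_append_rightI)

lemma gap_notin_r: "gap k \<in> S \<Longrightarrow> p @ gap k \<notin> r S"
  unfolding r_def using sublist_append_leftI by blast

lemma lie_pattern_Nil [simp]: "lie_pattern \<sigma> [] y = []"
  by (simp add: lie_pattern_def)

lemma lie_pattern_snoc [simp]:
  "lie_pattern \<sigma> (as @ [b]) y = lie_pattern \<sigma> as y @ [b \<noteq> (y \<in> \<sigma> as)]"
  by (simp add: lie_pattern_def nth_append)

lemma lie_pattern_Cons [simp]:
  "lie_pattern \<sigma> (b # as) y = (b \<noteq> (y \<in> \<sigma> [])) # lie_pattern (\<lambda>h. \<sigma> (b # h)) as y"
  unfolding lie_pattern_def length_Cons upt_conv_Cons[OF zero_less_Suc]
  by (simp add: map_Suc_upt[symmetric] comp_def del: map_Suc_upt upt_Suc)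

lemma lie_pattern_take: "lie_pattern \<sigma> (take i as) y = take i (lie_pattern \<sigma> as y)"
  by (rule nth_equalityI) (simp_all add: lie_pattern_def min.absorb1)


section \<open>Positions of the game\<close>

definition alive :: "bool list set \<Rightarrow> nat \<Rightarrow> (nat \<Rightarrow> bool list) \<Rightarrow> nat set" where
  "alive R N P = {y \<in> {1..N}. P y \<in> R}"

inductive wins :: "bool list set \<Rightarrow> nat \<Rightarrow> (nat \<Rightarrow> bool list) \<Rightarrow> bool" for R N where
  stop: "card (alive R N P) \<le> 1 \<Longrightarrow> wins R N P"
| ask: "A \<subseteq> {1..N} \<Longrightarrow> (\<And>b. wins R N (\<lambda>y. P y @ [b \<noteq> (y \<in> A)])) \<Longrightarrow> wins R N P"

text \<open>The strategies for the two answers are glued under the first question. Stating the bound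
  for all longer \<open>as\<close> lets the larger of the two bounds serve both.\<close>

lemma wins_imp_strategy:
  assumes "wins (r S) N P"
  shows "\<exists>\<sigma> k. (\<forall>h. \<sigma> h \<subseteq> {1..N}) \<and>
    (\<forall>as. k \<le> length as \<longrightarrow> card (alive (r S) N (\<lambda>y. P y @ lie_pattern \<sigma> as y)) \<le> 1)"
  using assms
proof induction
  case (stop P)
  \<comment> \<open>After stopping, patterns only grow, and a dead candidate stays dead.\<close>
  have "card (alive (r S) N (\<lambda>y. P y @ lie_pattern (\<lambda>_. {}) as y)) \<le> 1" for as
    by (intro order_trans[OF card_mono stop]) (auto simp: alive_def intro: r_prefix)
  then show ?case
    by (intro exI[of _ "\<lambda>_. {}"]) auto
next
  case (ask A P)
  obtain \<sigma>1 k1 where \<sigma>1: "\<forall>h. \<sigma>1 h \<subseteq> {1..N}" and k1: "\<forall>as. k1 \<le> length as \<longrightarrow>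
      card (alive (r S) N (\<lambda>y. (P y @ [True \<noteq> (y \<in> A)]) @ lie_pattern \<sigma>1 as y)) \<le> 1"
    using ask.IH[of True] by blast
  obtain \<sigma>0 k0 where \<sigma>0: "\<forall>h. \<sigma>0 h \<subseteq> {1..N}" and k0: "\<forall>as. k0 \<le> length as \<longrightarrow>
      card (alive (r S) N (\<lambda>y. (P y @ [False \<noteq> (y \<in> A)]) @ lie_pattern \<sigma>0 as y)) \<le> 1"
    using ask.IH[of False] by blast
  define \<tau> where "\<tau> h = (case h of [] \<Rightarrow> A | b # h' \<Rightarrow> if b then \<sigma>1 h' else \<sigma>0 h')" for h
  have "card (alive (r S) N (\<lambda>y. P y @ lie_pattern \<tau> as y)) \<le> 1"
    if "Suc (max k1 k0) \<le> length as" for as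
    using that k1 k0 by (cases as; cases "hd as") (simp_all add: \<tau>_def)
  moreover have "\<tau> h \<subseteq> {1..N}" for h
    using \<sigma>1 \<sigma>0 ask.hyps by (auto simp: \<tau>_def split: list.splits)
  ultimately show ?case
    by blast
qed

lemma seeker_wins_forI:
  assumes "wins (r S) N (\<lambda>_. [])"
  shows "seeker_wins_for (r S) N"
proof -
  from wins_imp_strategy[OF assms] obtain \<sigma> k where "\<forall>h. \<sigma> h \<subseteq> {1..N}"
    and "\<forall>as. k \<le> length as \<longrightarrow> card {y \<in> {1..N}. lie_pattern \<sigma> as y \<in> r S} \<le> 1"
    by (auto simp: alive_def)
  then show ?thesis
    unfolding seeker_wins_for_def by (intro exI[of _ \<sigma>] conjI exI[of _ k]) auto
qed

text \<open>The game reduced to two candidates: \<open>split\<close> is a question that contains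
  exactly one of them, \<open>join\<close> one that treats them alike.\<close>

inductive beats :: "bool list set \<Rightarrow> bool list \<Rightarrow> bool list \<Rightarrow> bool" for R where
  dead: "u \<notin> R \<or> v \<notin> R \<Longrightarrow> beats R u v"
| split: "beats R (u @ [False]) (v @ [True]) \<Longrightarrow> beats R (u @ [True]) (v @ [False]) \<Longrightarrow> beats R u v"
| join: "beats R (u @ [False]) (v @ [False]) \<Longrightarrow> beats R (u @ [True]) (v @ [True]) \<Longrightarrow> beats R u v"

text \<open>The questions \<open>{x}\<close> and \<open>{}\<close> realise \<open>split\<close> and
  \<open>join\<close>. The last premise is the continuation once \<open>x\<close> or
  \<open>y\<close> is dead; its prefix condition records that all other patterns have only
  grown.\<close>

lemma beats_imp_wins:
  assumes "beats R (P x) (P y)" and "x \<in> {1..N}" and "x \<noteq> y"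
    and "\<And>P'. (\<And>z. prefix (P z) (P' z)) \<Longrightarrow> P' x \<notin> R \<or> P' y \<notin> R \<Longrightarrow> wins R N P'"
  shows "wins R N P"
  using assms(1,4)
proof (induction "P x" "P y" arbitrary: P)
  case dead
  then show ?case by blast
next
  case split
  let ?Q = "\<lambda>b z. P z @ [b \<noteq> (z \<in> {x})]"
  have "wins R N (?Q b)" for b
  proof -
    have ext: "wins R N P'"
      if "\<And>z. prefix (?Q b z) (P' z)" "P' x \<notin> R \<or> P' y \<notin> R" for P'
      using that split.prems by (meson append_prefixD)
    show ?thesis
      using split.hyps(2)[of "?Q b"] split.hyps(4)[of "?Q b"] \<open>x \<noteq> y\<close> ext by (cases b) auto
  qed
  then show ?case
    using \<open>x \<in> {1..N}\<close> wins.ask[of "{x}"] by blast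
next
  case join
  let ?Q = "\<lambda>b z. P z @ [b \<noteq> (z \<in> {})]"
  have "wins R N (?Q b)" for b
  proof -
    have ext: "wins R N P'"
      if "\<And>z. prefix (?Q b z) (P' z)" "P' x \<notin> R \<or> P' y \<notin> R" for P'
      using that join.prems by (meson append_prefixD)
    show ?thesis
      using join.hyps(2)[of "?Q b"] join.hyps(4)[of "?Q b"] ext by (cases b) auto
  qed
  then show ?case
    using wins.ask[of "{}"] by blast
qed

lemma all_beats_imp_wins:
  assumes beats: "\<And>u v. beats (r S) u v"
  shows "wins (r S) N P"
proof (induction "card (alive (r S) N P)" arbitrary: P rule: less_induct)
  case less
  show ?case
  proof (cases "card (alive (r S) N P) \<le> 1")
    case True
    then show ?thesis by (rule wins.stop)
  next
    case False
    then obtain x y where xy: "x \<in> alive (r S) N P" "y \<in> alive (r S) N P" "x \<noteq> y"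
      using card_le_Suc0_iff_eq[of "alive (r S) N P"] by (force simp: alive_def)
    show ?thesis
    proof (rule beats_imp_wins[of _ P x y])
      fix P' assume P': "\<And>z. prefix (P z) (P' z)" "P' x \<notin> r S \<or> P' y \<notin> r S"
      then have "alive (r S) N P' \<subset> alive (r S) N P"
        using xy by (auto simp: alive_def intro: r_sublist)
      then show "wins (r S) N P'"
        by (intro less psubset_card_mono) (auto simp: alive_def)
    qed (use xy beats in \<open>auto simp: alive_def\<close>)
  qed
qed


section \<open>Two candidates, coprime gaps\<close>

lemma beats_sym: "beats R u v \<Longrightarrow> beats R v u"
  by (induction rule: beats.induct) (auto intro: beats.intros)

text \<open>The histories \<open>p\<close> and \<open>q\<close> are arbitrary because the Euclidean
  step re-enters such positions with longer ones.\<close>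

definition wins_lag :: "bool list set \<Rightarrow> nat \<Rightarrow> bool" where
  "wins_lag R k \<longleftrightarrow> (\<forall>p q. beats R (p @ [False]) (q @ False # replicate k True))"

context
  fixes S :: "bool list set"
  assumes gap0: "gap 0 \<in> S"
begin

lemma False_False_dead: "beats (r S) (p @ [False, False]) v"
  using gap_notin_r[OF gap0, of p] by (auto intro: beats.dead)

lemma beats_wait1: "beats (r S) (u @ [True]) (v @ [True]) \<Longrightarrow> beats (r S) u v"
proof (rule beats.join)
  \<comment> \<open>If both receive a 0, separate them: whoever receives the next 0 completes
    00.\<close>
  show "beats (r S) (u @ [False]) (v @ [False])"
    using False_False_dead[of u] False_False_dead[of v, THEN beats_sym]
    by - (rule beats.split, simp_all)
qed

lemma beats_wait:
  "beats (r S) (u @ replicate j True) (v @ replicate j True) \<Longrightarrow> beats (r S) u v"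
proof (induction j arbitrary: u v)
  case (Suc j)
  then have "beats (r S) (u @ [True]) (v @ [True])"
    by (simp add: Suc.IH)
  then show ?case by (rule beats_wait1)
qed simp

lemma wins_lag_gap:
  assumes "gap k \<in> S"
  shows "wins_lag (r S) k"
  unfolding wins_lag_def
proof (rule allI, rule allI, rule beats.split)
  fix p q
  show "beats (r S) ((p @ [False]) @ [False]) ((q @ False # replicate k True) @ [True])"
    using False_False_dead by simp
  show "beats (r S) ((p @ [False]) @ [True]) ((q @ False # replicate k True) @ [False])"
    using gap_notin_r[OF assms, of q] by (simp add: beats.dead)
qed

lemma wins_lag_diff:
  assumes "wins_lag (r S) (Suc j)" and "wins_lag (r S) (k + Suc j)"
  shows "wins_lag (r S) k"
  unfolding wins_lag_def
proof (intro allI)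
  fix p q
  let ?u = "p @ False # replicate j True" and ?v = "q @ False # replicate (k + j) True"
  \<comment> \<open>The counts are \<open>j\<close> and \<open>k + j\<close>: whoever is given the 0
    drops to 0, while the other moves on to \<open>Suc j\<close> or
    \<open>k + Suc j\<close>.\<close>
  have "beats (r S) ?u ?v"
  proof (rule beats.split)
    show "beats (r S) (?u @ [False]) (?v @ [True])"
      using assms(2)[unfolded wins_lag_def, rule_format, of ?u q]
      by (simp flip: replicate_append_same)
    show "beats (r S) (?u @ [True]) (?v @ [False])"
      using assms(1)[unfolded wins_lag_def, rule_format, of ?v p, THEN beats_sym]
      by (simp flip: replicate_append_same)
  qed
  then show "beats (r S) (p @ [False]) (q @ False # replicate k True)"
    by - (rule beats_wait[of _ j], simp add: replicate_add)
qed

lemma wins_lag_gcd: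
  assumes "wins_lag (r S) a" and "wins_lag (r S) b"
  shows "wins_lag (r S) (gcd a b)"
  using assms
proof (induction "a + b" arbitrary: a b rule: less_induct)
  case less
  have step: "wins_lag (r S) (gcd c d)"
    if "0 < c" "c \<le> d" "c + d = a + b" "wins_lag (r S) c" "wins_lag (r S) d" for c d
  proof -
    have "wins_lag (r S) (d - c)"
      using that wins_lag_diff[of "c - 1" "d - c"] by simp
    then have "wins_lag (r S) (gcd c (d - c))"
      using that by (intro less.hyps) auto
    then show ?thesis
      using that by (metis gcd.commute gcd_diff1_nat)
  qed
  show ?case
  proof (cases "a = 0 \<or> b = 0")
    case True
    then show ?thesis using less.prems by auto
  next
    case False
    then show ?thesis
      using step[of a b] step[of b a] less.prems by (cases "a \<le> b") (auto simp: gcd.commute)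
  qed
qed

lemma beats_if_wins_lag_1:
  assumes "wins_lag (r S) 1"
  shows "beats (r S) u v"
proof -
  \<comment> \<open>A separating question either completes 00 in the first pattern or makes the
    counts 1 and 0.\<close>
  have *: "beats (r S) (p @ [False]) w" for p w
  proof (rule beats.split)
    show "beats (r S) ((p @ [False]) @ [False]) (w @ [True])"
      using False_False_dead by simp
    show "beats (r S) ((p @ [False]) @ [True]) (w @ [False])"
      using assms[unfolded wins_lag_def, rule_format, of w p, THEN beats_sym] by simp
  qed
  then show ?thesis
    by (intro beats.split[of _ u v] * *[THEN beats_sym])
qed

end


section \<open>Two candidates, gaps with a common divisor\<close>

text \<open>The phase is the number of 1s after the last 0; it may start anywhere, since a gap begins
  only with the first 0.\<close>

inductive phase :: "nat \<Rightarrow> bool list \<Rightarrow> nat \<Rightarrow> bool" for d where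
  Nil: "phase d [] c"
| one: "phase d w c \<Longrightarrow> phase d (w @ [True]) (Suc c)"
| zero: "phase d w c \<Longrightarrow> \<not> d dvd c \<Longrightarrow> phase d (w @ [False]) 0"

lemma suffix_snoc_ones:
  "suffix (False # replicate j True) (w @ [b]) \<longleftrightarrow>
    (if b then \<exists>i. j = Suc i \<and> suffix (False # replicate i True) w else j = 0)"
  by (cases j) (auto simp: suffix_def simp flip: replicate_append_same)

text \<open>A 0 resets the phase, so from then on the free starting value is forgotten.\<close>

lemma phase_suffix: "phase d w c \<Longrightarrow> suffix (False # replicate j True) w \<Longrightarrow> c = j"
  by (induction arbitrary: j rule: phase.induct) (auto simp: suffix_snoc_ones simp del: suffix_snoc)

text \<open>Closing a gap of length \<open>k\<close> takes a 0 at phase \<open>k\<close>, which the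
  rule \<open>zero\<close> forbids.\<close>

lemma phase_no_gap: "phase d w c \<Longrightarrow> d dvd k \<Longrightarrow> \<not> sublist (gap k) w"
proof (induction rule: phase.induct)
  case (one w c)
  then show ?case
    by (auto simp: sublist_snoc suffix_def)
next
  case (zero w c)
  have "suffix (gap k) (w @ [False]) \<Longrightarrow> suffix (False # replicate k True) w"
    by (auto simp: suffix_def)
  then show ?case
    using zero phase_suffix by (auto simp: sublist_snoc)
qed simp

lemma two_phases_survive:
  fixes \<sigma> :: strategy
  assumes "d > 1"
  shows "\<exists>as a b. length as = k \<and> phase d (lie_pattern \<sigma> as x) a \<and>
    phase d (lie_pattern \<sigma> as y) b \<and> a mod d \<noteq> b mod d"
proof (induction k)
  case 0
  \<comment> \<open>The free start supplies two incongruent phases for the same empty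
    pattern.\<close>
  have "phase d [] 0" "phase d [] 1" "0 mod d \<noteq> 1 mod d"
    using assms by (auto intro: phase.Nil)
  then show ?case
    by (metis lie_pattern_Nil list.size(3))
next
  case (Suc k)
  then obtain as a b where as: "length as = k" and a: "phase d (lie_pattern \<sigma> as x) a"
    and b: "phase d (lie_pattern \<sigma> as y) b" and ab: "a mod d \<noteq> b mod d"
    by blast
  let ?x = "x \<in> \<sigma> as" and ?y = "y \<in> \<sigma> as"
  have step: ?case
    if "phase d (lie_pattern \<sigma> as x @ [c \<noteq> ?x]) a'" "phase d (lie_pattern \<sigma> as y @ [c \<noteq> ?y]) b'"
      "a' mod d \<noteq> b' mod d" for c a' b'
    using that as by (intro exI[of _ "as @ [c]"]) auto
  show ?case
  proof (cases "?x = ?y")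
    case True
    have "Suc a mod d \<noteq> Suc b mod d"
      using ab by (simp add: nat_mod_eq_iff)
    with True a b show ?thesis
      by (intro step[of "\<not> ?x" "Suc a" "Suc b"]) (auto intro: phase.one)
  next
    case False
    \<comment> \<open>One condition permits the 0, the other keeps the new phases incongruent. If
      both alternatives failed, \<open>d\<close> would divide \<open>a\<close> and \<open>b\<close>,
      or both successors, or two consecutive numbers.\<close>
    have "\<not> d dvd a \<and> \<not> d dvd Suc b \<or> \<not> d dvd b \<and> \<not> d dvd Suc a"
      using ab \<open>d > 1\<close> by (auto simp: mod_Suc dvd_eq_mod_eq_0 split: if_splits)
    then show ?thesis
    proof
      assume "\<not> d dvd a \<and> \<not> d dvd Suc b"
      with False a b show ?thesis
        by (intro step[of ?x 0 "Suc b"]) (auto simp: dvd_eq_mod_eq_0 intro: phase.intros)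
    next
      assume "\<not> d dvd b \<and> \<not> d dvd Suc a"
      with False a b show ?thesis
        by (intro step[of ?y "Suc a" 0]) (auto simp: dvd_eq_mod_eq_0 intro: phase.intros)
    qed
  qed
qed

lemma not_seeker_wins_for_2:
  assumes "d > 1" and "\<And>s. s \<in> S \<Longrightarrow> \<exists>k. d dvd k \<and> s = gap k"
  shows "\<not> seeker_wins_for (r S) 2"
proof
  assume "seeker_wins_for (r S) 2"
  then obtain \<sigma> k where win: "\<And>x as. x \<in> {1..2} \<Longrightarrow> length as = k \<Longrightarrow> legal_answers (r S) \<sigma> x as \<Longrightarrow>
      card {y \<in> {1..2}. lie_pattern \<sigma> as y \<in> r S} \<le> 1"
    unfolding seeker_wins_for_def by blast
  obtain as a b where as: "length as = k"
    and "phase d (lie_pattern \<sigma> as 1) a" "phase d (lie_pattern \<sigma> as 2) b"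
    using two_phases_survive[OF \<open>d > 1\<close>] by blast
  then have in_r: "lie_pattern \<sigma> as 1 \<in> r S" "lie_pattern \<sigma> as 2 \<in> r S"
    using phase_no_gap assms(2) by (fastforce simp: r_def)+
  \<comment> \<open>Prefixes of a pattern in \<open>r S\<close> lie in \<open>r S\<close>, so
    survival at the end makes every earlier answer legal.\<close>
  have "legal_answers (r S) \<sigma> 1 as"
    unfolding legal_answers_def lie_pattern_take
    using r_sublist[OF in_r(1)] by (meson take_is_prefix prefix_imp_sublist)
  then have "card {y \<in> {1..2}. lie_pattern \<sigma> as y \<in> r S} \<le> 1"
    using win[of 1] as by simp
  moreover have "{y \<in> {1..2}. lie_pattern \<sigma> as y \<in> r S} = {1, 2}"
    using in_r by (auto simp: numeral_2_eq_2 le_Suc_eq)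
  ultimately show False by simp
qed

theorem theorem9:
  fixes m n :: nat
  assumes "m \<ge> 1" and "n \<ge> 1"
  shows "seeker_wins (r {[False, False],
                         False # replicate m True @ [False],
                         False # replicate n True @ [False]})
         \<longleftrightarrow> gcd m n = 1"
    (is "seeker_wins (r ?S) \<longleftrightarrow> _")
proof
  assume gcd: "gcd m n = 1"
  have "wins_lag (r ?S) 1"
    using wins_lag_gcd[of ?S m n] wins_lag_gap[of ?S m] wins_lag_gap[of ?S n] gcd by simp
  then have "beats (r ?S) u v" for u v
    by (intro beats_if_wins_lag_1) simp_all
  then show "seeker_wins (r ?S)"
    unfolding seeker_wins_def using all_beats_imp_wins seeker_wins_forI by blast
next
  assume win: "seeker_wins (r ?S)"
  show "gcd m n = 1"
  proof (rule ccontr)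
    assume "gcd m n \<noteq> 1"
    then have "gcd m n > 1"
      using assms by (metis One_nat_def Suc_lessI gcd_pos_nat not_one_le_zero)
    moreover have "\<exists>k. gcd m n dvd k \<and> s = gap k" if "s \<in> ?S" for s
    proof -
      have "s = gap 0 \<or> s = gap m \<or> s = gap n"
        using that by simp
      then show ?thesis
        by (metis dvd_0_right gcd_dvd1 gcd_dvd2)
    qed
    ultimately have "\<not> seeker_wins_for (r ?S) 2"
      by (rule not_seeker_wins_for_2)
    with win show False
      by (simp add: seeker_wins_def)
  qed
qed

end
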